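(* Let $S$ be a $*$-monoid and let $a,w,v\in S$. Then: (i) $a$ is $w$-core invertible if and only if $aw$ is $(a,a^* )$-invertible. In this case, the $w$-core inverse of $a$ coincides with the $(a,a^* )$-inverse of $aw$. (ii) $a$ is dual $v$-core invertible if and only if $va$ is $(a^*,a)$-invertible. In this case, the dual $v$-core inverse of $a$ coincides with the $(a^*,a)$-inverse of $va$.
   Context: A $*$-monoid is a semigroup $S$ with identity $1$ and a map $*$ satisfying $(x^* )^*=x$ and $(xy)^*=y^*x^*$ for all $x,y\in S$. For $a,w\in S$, $a$ is $w$-core invertible if there exists $x\in S$ with $awx^2=x$, $xawa=a$ and $(awx)^*=awx$. Such an $x$ is unique if it exists and is called the $w$-core inverse of $a$. For $a,v\in S$, $a$ is dual $v$-core invertible if there exists $y\in S$ with $avay=a$, $y^2va=y$ and $(yva)^*=yva$. Such a $y$ is unique if it exists and is called the dual $v$-core inverse of $a$. For $d,b,c\in S$, $d$ is $(b,c)$-invertible if there exists $y\in S$ with $ydb=b$, $cdy=c$ and $y\in bSy\cap ySc$; equivalently, $ydy=y$, $yS=bS$ and $Sy=Sc$. Such a $y$ is unique if it exists and is called the $(b,c)$-inverse of $d$. *)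

theory Defs
  imports Main
begin

class star_monoid = monoid_mult +
  fixes star :: "'a \<Rightarrow> 'a"  ("_\<^sup>\<star>" [1000] 999)
  assumes star_star: "(x\<^sup>\<star>)\<^sup>\<star> = x"
    and star_mult: "(x * y)\<^sup>\<star> = y\<^sup>\<star> * x\<^sup>\<star>"

definition is_core_inverse :: "'a::star_monoid \<Rightarrow> 'a \<Rightarrow> 'a \<Rightarrow> bool" where
  "is_core_inverse w a x \<longleftrightarrow>
     a * w * x\<^sup>2 = x \<and> x * a * w * a = a \<and> (a * w * x)\<^sup>\<star> = a * w * x"

definition core_invertible :: "'a::star_monoid \<Rightarrow> 'a \<Rightarrow> bool" where
  "core_invertible w a \<longleftrightarrow> (\<exists>x. is_core_inverse w a x)"

definition core_inverse :: "'a::star_monoid \<Rightarrow> 'a \<Rightarrow> 'a" where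
  "core_inverse w a = (THE x. is_core_inverse w a x)"

definition is_dual_core_inverse :: "'a::star_monoid \<Rightarrow> 'a \<Rightarrow> 'a \<Rightarrow> bool" where
  "is_dual_core_inverse v a y \<longleftrightarrow>
     a * v * a * y = a \<and> y\<^sup>2 * v * a = y \<and> (y * v * a)\<^sup>\<star> = y * v * a"

definition dual_core_invertible :: "'a::star_monoid \<Rightarrow> 'a \<Rightarrow> bool" where
  "dual_core_invertible v a \<longleftrightarrow> (\<exists>y. is_dual_core_inverse v a y)"

definition dual_core_inverse :: "'a::star_monoid \<Rightarrow> 'a \<Rightarrow> 'a" where
  "dual_core_inverse v a = (THE y. is_dual_core_inverse v a y)"

definition is_bc_inverse :: "'a::monoid_mult \<Rightarrow> 'a \<Rightarrow> 'a \<Rightarrow> 'a \<Rightarrow> bool" where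
  "is_bc_inverse b c d y \<longleftrightarrow>
     y * d * b = b \<and> c * d * y = c \<and>
     y \<in> {b * s * y |s. s \<in> UNIV} \<inter> {y * s * c |s. s \<in> UNIV}"

definition bc_invertible :: "'a::monoid_mult \<Rightarrow> 'a \<Rightarrow> 'a \<Rightarrow> bool" where
  "bc_invertible b c d \<longleftrightarrow> (\<exists>y. is_bc_inverse b c d y)"

definition bc_inverse :: "'a::monoid_mult \<Rightarrow> 'a \<Rightarrow> 'a \<Rightarrow> 'a" where
  "bc_inverse b c d = (THE y. is_bc_inverse b c d y)"

text \<open>Each of the three inverses is unique if it exists, so the definite descriptions above
  denote it whenever the element is invertible.\<close>

lemma is_core_inverse_unique:
  assumes "is_core_inverse w a x" and "is_core_inverse w a z"
  shows "x = z"
proof -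
  have x: "a * (w * (x * x)) = x" "x * (a * (w * a)) = a" "(a * (w * x))\<^sup>\<star> = a * (w * x)"
    and z: "a * (w * (z * z)) = z" "z * (a * (w * a)) = a" "(a * (w * z))\<^sup>\<star> = a * (w * z)"
    using assms by (simp_all add: is_core_inverse_def power2_eq_square mult.assoc)
  have absorb: "p * (a * (w * q)) = q"
    if "p * (a * (w * a)) = a" "a * (w * (q * q)) = q" for p q
  proof -
    have "p * (a * (w * q)) = p * (a * (w * (a * (w * (q * q)))))" using that(2) by simp
    also have "\<dots> = p * (a * (w * a)) * (w * (q * q))" by (simp add: mult.assoc)
    also have "\<dots> = q" using that by (simp add: mult.assoc)
    finally show ?thesis .
  qed
  have xx: "x * (a * (w * x)) = x" and xz: "x * (a * (w * z)) = z" and zx: "z * (a * (w * x)) = x"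
    using absorb x z by blast+
  have "a * (w * z) = (a * (w * z))\<^sup>\<star>" using z by simp
  also have "\<dots> = ((a * (w * x)) * (a * (w * z)))\<^sup>\<star>" by (simp add: xz mult.assoc)
  also have "\<dots> = (a * (w * z)) * (a * (w * x))" using x z by (simp only: star_mult)
  also have "\<dots> = a * (w * x)" by (simp add: zx mult.assoc)
  finally show ?thesis using xx xz by simp
qed

lemma is_dual_core_inverse_unique:
  assumes "is_dual_core_inverse v a y" and "is_dual_core_inverse v a z"
  shows "y = z"
proof -
  have y: "a * v * a * y = a" "y * y * v * a = y" "(y * v * a)\<^sup>\<star> = y * v * a"
    and z: "a * v * a * z = a" "z * z * v * a = z" "(z * v * a)\<^sup>\<star> = z * v * a"
    using assms by (simp_all add: is_dual_core_inverse_def power2_eq_square)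
  have absorb: "q * v * a * p = q" if "a * v * a * p = a" "q * q * v * a = q" for p q
  proof -
    have "q * v * a * p = q * q * v * a * v * a * p" using that(2) by simp
    also have "\<dots> = q * q * v * (a * v * a * p)" by (simp add: mult.assoc)
    also have "\<dots> = q" using that by simp
    finally show ?thesis .
  qed
  have yy: "y * v * a * y = y" and zy: "z * v * a * y = z" and yz: "y * v * a * z = y"
    using absorb y z by blast+
  have "z * v * a = (z * v * a)\<^sup>\<star>" using z by simp
  also have "\<dots> = ((z * v * a * y) * v * a)\<^sup>\<star>" by (simp only: zy)
  also have "\<dots> = ((z * v * a) * (y * v * a))\<^sup>\<star>" by (simp only: mult.assoc)
  also have "\<dots> = (y * v * a) * (z * v * a)" using y z by (simp only: star_mult)
  also have "\<dots> = (y * v * a * z) * v * a" by (simp only: mult.assoc)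
  also have "\<dots> = y * v * a" by (simp only: yz)
  finally show ?thesis using yy zy by simp
qed

lemma is_bc_inverse_unique:
  assumes "is_bc_inverse b c d y" and "is_bc_inverse b c d z"
  shows "y = z"
proof -
  obtain s t where s: "y = y * s * c" and t: "z = b * t * z"
    using assms by (auto simp: is_bc_inverse_def)
  have "y * d * z = y * s * (c * d * z)" by (subst s) (simp add: mult.assoc)
  also have "\<dots> = y" using assms(2) s by (simp add: is_bc_inverse_def)
  finally have "y * d * z = y" .
  moreover have "y * d * z = (y * d * b) * t * z" by (subst t) (simp add: mult.assoc)
  hence "y * d * z = z" using assms(1) t by (simp add: is_bc_inverse_def)
  ultimately show ?thesis by simp
qed

end

theory Submission
  imports Defs
begin

text \<open>Both inverses are solution sets of equations, and each pair of sets coincides element by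
  element, so existence and the inverses agree together. The link is \<open>p = a * w * x\<close>.
  Being a core inverse forces \<open>p * a = a\<close> and makes \<open>p\<close> self-adjoint;
  applying star yields \<open>a\<^sup>\<star> * p = a\<^sup>\<star>\<close>, the condition on the
  \<open>c\<close> side. Conversely, that condition gives \<open>p\<^sup>\<star> * a = a\<close>,
  hence \<open>p\<^sup>\<star> * p = p\<close>, which forces self-adjointness. The dual case uses
  \<open>y * v * a\<close> with all products reversed.\<close>

text \<open>A product \<open>p\<^sup>\<star> * p\<close> is always fixed by star, so
  \<open>p\<close> is too once it equals that product.\<close>

lemma self_adjoint_if_star_mult_self:
  fixes p :: "'a::star_monoid"
  assumes "p\<^sup>\<star> * p = p"
  shows "p\<^sup>\<star> = p"
  using star_mult[of "p\<^sup>\<star>" p] assms by (simp add: star_star)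

lemma self_adjoint_if_mult_star_self:
  fixes p :: "'a::star_monoid"
  assumes "p * p\<^sup>\<star> = p"
  shows "p\<^sup>\<star> = p"
  using star_mult[of p "p\<^sup>\<star>"] assms by (simp add: star_star)

lemma is_core_inverse_iff_is_bc_inverse:
  fixes a w x :: "'a::star_monoid"
  shows "is_core_inverse w a x \<longleftrightarrow> is_bc_inverse a (a\<^sup>\<star>) (a * w) x"
proof
  assume "is_core_inverse w a x"
  then have sq: "a * w * x * x = x" and left: "x * a * w * a = a"
    and sa: "(a * w * x)\<^sup>\<star> = a * w * x"
    by (simp_all add: is_core_inverse_def power2_eq_square mult.assoc)
  \<comment> \<open>Expanding the last \<open>a\<close> creates the square of \<open>x\<close>,
    which \<open>sq\<close> collapses.\<close>
  have "a * w * x * a = a * w * x * (x * a * w * a)" by (simp only: left)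
  also have "\<dots> = (a * w * x * x) * a * w * a" by (simp only: mult.assoc)
  finally have "a * w * x * a = a" by (simp only: sq left)
  then have "(a * w * x * a)\<^sup>\<star> = a\<^sup>\<star>" by simp
  then have right: "a\<^sup>\<star> * (a * w) * x = a\<^sup>\<star>"
    using star_mult[of "a * w * x" a] sa by (simp add: mult.assoc)
  have "x * (a * w * x) = x * a * w * x" by (simp only: mult.assoc)
  also have "\<dots> = x * a * w * (a * w * x * x)" by (simp only: sq)
  also have "\<dots> = (x * a * w * a) * w * x * x" by (simp only: mult.assoc)
  finally have "x * (a * w * x) = x" by (simp only: left sq)
  \<comment> \<open>Replacing the self-adjoint \<open>a * w * x\<close> by its star brings
    \<open>a\<^sup>\<star>\<close> to the right end.\<close>
  then have "x = x * (w * x)\<^sup>\<star> * a\<^sup>\<star>"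
    using sa star_mult[of a "w * x"] by (simp add: mult.assoc)
  then have "\<exists>s. x = x * s * a\<^sup>\<star>" by blast
  moreover have "x = a * (w * x) * x" using sq by (simp add: mult.assoc)
  then have "\<exists>s. x = a * s * x" by blast
  ultimately show "is_bc_inverse a (a\<^sup>\<star>) (a * w) x"
    using left right by (simp add: is_bc_inverse_def mult.assoc)
next
  assume "is_bc_inverse a (a\<^sup>\<star>) (a * w) x"
  then obtain s where left: "x * a * w * a = a" and right: "a\<^sup>\<star> * (a * w * x) = a\<^sup>\<star>"
    and s: "x = a * s * x"
    by (auto simp: is_bc_inverse_def mult.assoc)
  have absorb: "(a * w * x)\<^sup>\<star> * a = a"
    using arg_cong[OF right, of star] by (simp only: star_mult star_star)
  \<comment> \<open>Multiply \<open>absorb\<close> on the right by \<open>w * x\<close>.\<close>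
  have "(a * w * x)\<^sup>\<star> * (a * w * x) = a * w * x"
    using arg_cong[OF absorb, of "\<lambda>u. u * (w * x)"] by (simp only: mult.assoc)
  then have sa: "(a * w * x)\<^sup>\<star> = a * w * x"
    by (rule self_adjoint_if_star_mult_self)
  \<comment> \<open>As \<open>x\<close> lies in \<open>a * S * x\<close>, whatever fixes
    \<open>a\<close> from the left also fixes \<open>x\<close>.\<close>
  have "a * w * x * x = (a * w * x * a) * s * x" by (subst (2) s) (simp only: mult.assoc)
  also have "\<dots> = x" using absorb s by (simp add: sa)
  finally show "is_core_inverse w a x"
    using left sa by (simp add: is_core_inverse_def power2_eq_square mult.assoc)
qed

text \<open>This is the previous equivalence read in the opposite monoid: reversal exchanges the
  roles of \<open>b\<close> and \<open>c\<close> and turns \<open>a * w\<close> into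
  \<open>v * a\<close>.\<close>

lemma is_dual_core_inverse_iff_is_bc_inverse:
  fixes a v y :: "'a::star_monoid"
  shows "is_dual_core_inverse v a y \<longleftrightarrow> is_bc_inverse (a\<^sup>\<star>) a (v * a) y"
proof
  assume "is_dual_core_inverse v a y"
  then have sq: "y * y * v * a = y" and right: "a * v * a * y = a"
    and sa: "(y * v * a)\<^sup>\<star> = y * v * a"
    by (simp_all add: is_dual_core_inverse_def power2_eq_square mult.assoc)
  have "a * (y * v * a) = a * v * a * y * (y * v * a)" by (simp only: right)
  also have "\<dots> = a * v * a * (y * y * v * a)" by (simp only: mult.assoc)
  finally have "a * (y * v * a) = a" by (simp only: sq right)
  then have "(a * (y * v * a))\<^sup>\<star> = a\<^sup>\<star>" by simp
  then have left: "y * (v * a) * a\<^sup>\<star> = a\<^sup>\<star>"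
    using star_mult[of a "y * v * a"] sa by (simp add: mult.assoc)
  have "y * v * a * y = (y * y * v * a) * v * a * y" by (simp only: sq)
  also have "\<dots> = y * y * v * (a * v * a * y)" by (simp only: mult.assoc)
  finally have "y * v * a * y = y" by (simp only: right sq)
  then have "y = a\<^sup>\<star> * (y * v)\<^sup>\<star> * y"
    using sa star_mult[of "y * v" a] by simp
  then have "\<exists>s. y = a\<^sup>\<star> * s * y" by blast
  moreover have "y = y * (y * v) * a" using sq by (simp add: mult.assoc)
  then have "\<exists>s. y = y * s * a" by blast
  ultimately show "is_bc_inverse (a\<^sup>\<star>) a (v * a) y"
    using left right by (simp add: is_bc_inverse_def mult.assoc)
next
  assume "is_bc_inverse (a\<^sup>\<star>) a (v * a) y"
  then obtain s where left: "y * v * a * a\<^sup>\<star> = a\<^sup>\<star>" and right: "a * v * a * y = a"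
    and s: "y = y * s * a"
    by (auto simp: is_bc_inverse_def mult.assoc)
  have absorb: "a * (y * v * a)\<^sup>\<star> = a"
    using arg_cong[OF left, of star] by (simp only: star_mult star_star)
  have "(y * v * a) * (y * v * a)\<^sup>\<star> = y * v * a"
    using arg_cong[OF absorb, of "\<lambda>u. (y * v) * u"] by (simp only: mult.assoc)
  then have sa: "(y * v * a)\<^sup>\<star> = y * v * a"
    by (rule self_adjoint_if_mult_star_self)
  \<comment> \<open>Only the leading \<open>y\<close> is expanded, exposing an \<open>a\<close> that
    absorbs \<open>y * v * a\<close> on its right.\<close>
  have "y * y * v * a = y * s * (a * (y * v * a))" by (subst (1) s) (simp only: mult.assoc)
  also have "\<dots> = y" using absorb s by (simp add: sa)
  finally show "is_dual_core_inverse v a y"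
    using right sa by (simp add: is_dual_core_inverse_def power2_eq_square mult.assoc)
qed

theorem theorem2p28:
  fixes a w v :: "'a::star_monoid"
  shows "((core_invertible w a \<longleftrightarrow> bc_invertible a (a\<^sup>\<star>) (a * w)) \<and>
          (core_invertible w a \<longrightarrow> core_inverse w a = bc_inverse a (a\<^sup>\<star>) (a * w))) \<and>
         ((dual_core_invertible v a \<longleftrightarrow> bc_invertible (a\<^sup>\<star>) a (v * a)) \<and>
          (dual_core_invertible v a \<longrightarrow>
             dual_core_inverse v a = bc_inverse (a\<^sup>\<star>) a (v * a)))"
  \<comment> \<open>Equivalent predicates have the same existence statement and the same
    \<open>THE\<close> value.\<close>
  by (simp add: core_invertible_def core_inverse_def dual_core_invertible_def
      dual_core_inverse_def bc_invertible_def bc_inverse_def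
      is_core_inverse_iff_is_bc_inverse is_dual_core_inverse_iff_is_bc_inverse)

end
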